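(* Let $\Sigma$ be a system of the form $$\dot x=g_0(x)+\sum_{i=1}^m u_i\,g_i(x),\qquad x\in\mathbb{R},\ u=(u_1,\dots,u_m)\in\mathbb{R}^m,$$ with one-dimensional state, where $g_0,\dots,g_m:\mathbb{R}\to\mathbb{R}$ are locally Lipschitz. Assume that for some $\gamma>0$ there exists a locally Lipschitz $V\in\mathcal{W}_\infty(\Sigma,\gamma)$. Then $\mathcal{W}_\infty(\Sigma,\gamma)\cap\mathcal{C}^1_0\neq\emptyset$.
   Context: Notation: $|\cdot|$ is the Euclidean norm. For $V:\mathbb{R}^n\to\mathbb{R}$ and $x\in\mathbb{R}^n$, the viscosity subdifferential $\partial_D V(x)$ is the (possibly empty) set of all $\zeta\in\mathbb{R}^n$ such that $$\liminf_{h\to 0}\frac{1}{|h|}\left[V(x+h)-V(x)-\zeta\cdot h\right]\ge 0 .$$ For a system $\Sigma:\ \dot x=F(x,u)$ with $x\in\mathbb{R}^n$, $u\in\mathcal{U}$, and $\gamma\ge 0$, $\mathcal{W}(\Sigma,\gamma)$ is the set of all continuous $V:\mathbb{R}^n\to\mathbb{R}_{\ge0}$ such that $$\zeta\cdot F(x,u)\le -|x|^2+\gamma|u|^2\quad\text{for all }x\in\mathbb{R}^n\setminus\{0\},\ u\in\mathcal{U},\ \zeta\in\partial_D V(x).$$ A continuous $V:\mathbb{R}^n\to\mathbb{R}_{\ge0}$ is proper if $\{x: V(x)\le a\}$ is compact for every $a>0$, and positive definite if $V(x)=0$ if and only if $x=0$. $\mathcal{W}_\infty(\Sigma,\gamma)$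 is the set of $V\in\mathcal{W}(\Sigma,\gamma)$ that are proper and positive definite. $\mathcal{C}^1_0$ is the set of continuous functions $V:\mathbb{R}^n\to\mathbb{R}_{\ge0}$ whose restriction to $\mathbb{R}^n\setminus\{0\}$ is continuously differentiable. Here $n=1$ and $\mathcal{U}=\mathbb{R}^m$. *)

theory Defs
  imports "HOL-Analysis.Analysis"
begin

text \<open>The lower limit is taken in the extended reals, since the quotient need not be bounded.\<close>

definition visc_subdiff :: "('a::euclidean_space \<Rightarrow> real) \<Rightarrow> 'a \<Rightarrow> 'a set" where
  "visc_subdiff V x =
    {\<zeta>. Liminf (at 0) (\<lambda>h. ereal ((1 / norm h) * (V (x + h) - V x - \<zeta> \<bullet> h))) \<ge> 0}"

text \<open>A system is given by its right-hand side \<open>F\<close> and its set \<open>U\<close> of input values.\<close>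

definition storage_W ::
  "('a::euclidean_space \<Rightarrow> 'u::euclidean_space \<Rightarrow> 'a) \<Rightarrow> 'u set \<Rightarrow> real \<Rightarrow> ('a \<Rightarrow> real) set" where
  "storage_W F U \<gamma> =
    {V. continuous_on UNIV V \<and> (\<forall>x. V x \<ge> 0) \<and>
        (\<forall>x \<in> - {0}. \<forall>u \<in> U. \<forall>\<zeta> \<in> visc_subdiff V x.
           \<zeta> \<bullet> F x u \<le> - (norm x)\<^sup>2 + \<gamma> * (norm u)\<^sup>2)}"

definition proper_fun :: "('a::euclidean_space \<Rightarrow> real) \<Rightarrow> bool" where
  "proper_fun V \<longleftrightarrow> (\<forall>a>0. compact {x. V x \<le> a})"

definition positive_definite_fun :: "('a::euclidean_space \<Rightarrow> real) \<Rightarrow> bool" where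
  "positive_definite_fun V \<longleftrightarrow> (\<forall>x. V x = 0 \<longleftrightarrow> x = 0)"

definition storage_W_inf ::
  "('a::euclidean_space \<Rightarrow> 'u::euclidean_space \<Rightarrow> 'a) \<Rightarrow> 'u set \<Rightarrow> real \<Rightarrow> ('a \<Rightarrow> real) set" where
  "storage_W_inf F U \<gamma> =
    {V \<in> storage_W F U \<gamma>. proper_fun V \<and> positive_definite_fun V}"

definition C1_0 :: "('a::euclidean_space \<Rightarrow> real) set" where
  "C1_0 =
    {V. continuous_on UNIV V \<and> (\<forall>x. V x \<ge> 0) \<and>
        (\<exists>D. (\<forall>x \<in> - {0}. GDERIV V x :> D x) \<and> continuous_on (- {0}) D)}"

text \<open>The library notion is for time-dependent maps; the time argument is a dummy here.\<close>

definition locally_lipschitz :: "('a::metric_space \<Rightarrow> 'b::metric_space) \<Rightarrow> bool" where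
  "locally_lipschitz f \<longleftrightarrow> local_lipschitz (UNIV :: real set) UNIV (\<lambda>_. f)"

definition affine_system ::
  "(real \<Rightarrow> real) \<Rightarrow> ('m::finite \<Rightarrow> real \<Rightarrow> real) \<Rightarrow> real \<Rightarrow> real ^ 'm \<Rightarrow> real" where
  "affine_system g0 g x u = g0 x + (\<Sum>i\<in>UNIV. u $ i * g i x)"

end

theory Submission
  imports Defs
begin

text \<open>Maximising over \<open>u\<close>, the dissipation inequality at \<open>x\<close> becomes the quadratic inequality
  \<open>G p\<^sup>2 + g\<^sub>0 p + x\<^sup>2 \<le> 0\<close> for the subgradient \<open>p\<close>, where \<open>G = (\<Sum>i. g\<^sub>i\<^sup>2) / (4 \<gamma>)\<close>. Subgradients of
  \<open>V\<close> exist on a dense set and are locally bounded, so by a limit argument the inequality has a solution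
  at every \<open>x \<noteq> 0\<close>; hence \<open>g\<^sub>0\<close> has no zero there, and properness of \<open>V\<close> forces \<open>x g\<^sub>0(x) < 0\<close>.
  On the half-line \<open>x > 0\<close> let \<open>p\<close> be the minimum of the larger root of the quadratic and a continuous
  majorant \<open>\<phi>\<close> of the subgradients of \<open>V\<close>. Then \<open>p\<close> is a continuous solution of the inequality dominating
  all subgradients of \<open>V\<close>, so the primitive of \<open>p\<close> grows at least as fast as \<open>V\<close> and is proper.
  The negative half-line follows by reflection.\<close>

section \<open>Viscosity subgradients on the real line\<close>

lemma visc_subdiff_real_iff:
  fixes V :: "real \<Rightarrow> real"
  shows "\<zeta> \<in> visc_subdiff V x \<longleftrightarrow>
    (\<forall>e>0. \<exists>d>0. \<forall>h. \<bar>h\<bar> < d \<longrightarrow> V (x + h) - V x - \<zeta> * h \<ge> - e * \<bar>h\<bar>)"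
    (is "_ \<longleftrightarrow> ?R")
proof
  assume "\<zeta> \<in> visc_subdiff V x"
  then have *: "\<And>y. y < 0 \<Longrightarrow> \<forall>\<^sub>F h in at 0. y < ereal ((1 / norm h) * (V (x + h) - V x - \<zeta> \<bullet> h))"
    by (simp add: visc_subdiff_def le_Liminf_iff)
  show ?R
  proof (intro allI impI)
    fix e :: real assume "e > 0"
    from *[of "ereal (- e)"] this obtain d where d: "d > 0"
      "\<And>h. h \<noteq> 0 \<Longrightarrow> \<bar>h\<bar> < d \<Longrightarrow> - e < (1 / norm h) * (V (x + h) - V x - \<zeta> \<bullet> h)"
      by (auto simp: eventually_at)
    have "V (x + h) - V x - \<zeta> * h \<ge> - e * \<bar>h\<bar>" if "\<bar>h\<bar> < d" for h
      using d(2)[of h] that by (cases "h = 0") (auto simp: field_simps)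
    with d(1) show "\<exists>d>0. \<forall>h. \<bar>h\<bar> < d \<longrightarrow> V (x + h) - V x - \<zeta> * h \<ge> - e * \<bar>h\<bar>"
      by blast
  qed
next
  assume R: ?R
  have "\<forall>\<^sub>F h in at 0. y < ereal ((1 / norm h) * (V (x + h) - V x - \<zeta> \<bullet> h))" if "y < 0" for y
  proof -
    \<comment> \<open>\<open>y\<close> may be minus infinity, so a real level strictly between
      \<open>y\<close> and \<open>0\<close> is interposed.\<close>
    obtain e where e: "e > 0" "y < ereal (- e)"
    proof -
      obtain z where "y < ereal z" "ereal z < 0" using ereal_dense2[OF \<open>y < 0\<close>] by blast
      then show ?thesis using that[of "- z"] by simp
    qed
    obtain d where d: "d > 0" "\<And>h. \<bar>h\<bar> < d \<Longrightarrow> V (x + h) - V x - \<zeta> * h \<ge> - e * \<bar>h\<bar>"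
      using R e(1) by blast
    have "- e \<le> (1 / norm h) * (V (x + h) - V x - \<zeta> \<bullet> h)" if "\<bar>h\<bar> < d" "h \<noteq> 0" for h
      using d(2)[OF that(1)] that(2) by (auto simp: field_simps)
    then show ?thesis
      unfolding eventually_at using d(1) e(2)
      by (intro exI[of _ d]) (auto intro: order.strict_trans2)
  qed
  then show "\<zeta> \<in> visc_subdiff V x"
    by (simp add: visc_subdiff_def le_Liminf_iff)
qed

text \<open>At a local minimum of \<open>f - \<psi>\<close> the increments of \<open>f\<close>
  dominate those of \<open>\<psi>\<close>, and the first-order expansion of \<open>\<psi>\<close>
  supplies the slope \<open>D\<close>. Subgradients are produced in this way below.\<close>

lemma DERIV_minorant_in_visc_subdiff:
  fixes f \<psi> :: "real \<Rightarrow> real"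
  assumes "(\<psi> has_real_derivative D) (at x)"
    and "r > 0" "\<And>y. \<bar>y - x\<bar> < r \<Longrightarrow> f x - \<psi> x \<le> f y - \<psi> y"
  shows "D \<in> visc_subdiff f x"
  unfolding visc_subdiff_real_iff
proof (intro allI impI)
  fix e :: real assume "e > 0"
  then obtain d where d: "d > 0" "\<And>y. norm (y - x) < d \<Longrightarrow> norm (\<psi> y - \<psi> x - D * (y - x)) \<le> e * norm (y - x)"
    using assms(1) unfolding has_field_derivative_def has_derivative_at_alt by blast
  have "f (x + h) - f x - D * h \<ge> - e * \<bar>h\<bar>" if "\<bar>h\<bar> < min d r" for h
    using d(2)[of "x + h"] assms(3)[of "x + h"] that by auto
  then show "\<exists>d>0. \<forall>h. \<bar>h\<bar> < d \<longrightarrow> f (x + h) - f x - D * h \<ge> - e * \<bar>h\<bar>"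
    using d(1) \<open>r > 0\<close> by (intro exI[of _ "min d r"]) auto
qed

text \<open>The increments \<open>t\<close> and \<open>- t\<close> bound \<open>\<zeta> - D\<close>
  from both sides: the expansion of \<open>f\<close> and the subgradient inequality each contribute
  an error \<open>e / 2\<close> per unit length.\<close>

lemma visc_subdiff_DERIV_unique:
  fixes f :: "real \<Rightarrow> real"
  assumes f: "(f has_real_derivative D) (at x)" and \<zeta>: "\<zeta> \<in> visc_subdiff f x"
  shows "\<zeta> = D"
proof -
  have "\<bar>\<zeta> - D\<bar> \<le> 0 + e" if "e > 0" for e :: real
  proof -
    have e2: "e / 2 > 0" using that by simp
    obtain d where d: "d > 0" "\<And>y. norm (y - x) < d \<Longrightarrow> norm (f y - f x - D * (y - x)) \<le> e / 2 * norm (y - x)"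
      using f e2 unfolding has_field_derivative_def has_derivative_at_alt by blast
    obtain d' where d': "d' > 0" "\<And>h. \<bar>h\<bar> < d' \<Longrightarrow> f (x + h) - f x - \<zeta> * h \<ge> - (e / 2) * \<bar>h\<bar>"
      using \<zeta> e2 unfolding visc_subdiff_real_iff by blast
    define t where "t = min d d' / 2"
    have t: "t > 0" "t < d" "t < d'" using d(1) d'(1) by (auto simp: t_def)
    have "(\<zeta> - D) * t \<le> e * t"
      using d(2)[of "x + t"] d'(2)[of t] t unfolding real_norm_def abs_le_iff
      by (simp add: algebra_simps)
    moreover have "(D - \<zeta>) * t \<le> e * t"
      using d(2)[of "x - t"] d'(2)[of "- t"] t unfolding real_norm_def abs_le_iff
      by (simp add: algebra_simps)
    ultimately have "\<zeta> - D \<le> e" "D - \<zeta> \<le> e" using t(1) by auto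
    then show ?thesis by auto
  qed
  then have "\<bar>\<zeta> - D\<bar> \<le> 0" by (rule field_le_epsilon)
  then show ?thesis by simp
qed

text \<open>For a small \<open>t\<close> both \<open>x + t\<close> and \<open>x - t\<close> lie in
  the interval, where \<open>f\<close> changes by at most \<open>L * t\<close>; the subgradient
  inequality at these two increments bounds \<open>\<zeta>\<close> and \<open>- \<zeta>\<close> by
  \<open>L + e\<close>.\<close>

lemma visc_subdiff_lipschitz_bound:
  fixes f :: "real \<Rightarrow> real"
  assumes L: "L-lipschitz_on {a..b} f" and x: "a < x" "x < b" and \<zeta>: "\<zeta> \<in> visc_subdiff f x"
  shows "\<bar>\<zeta>\<bar> \<le> L"
proof (rule field_le_epsilon)
  fix e :: real assume "e > 0"
  then obtain d where d: "d > 0" "\<And>h. \<bar>h\<bar> < d \<Longrightarrow> f (x + h) - f x - \<zeta> * h \<ge> - e * \<bar>h\<bar>"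
    using \<zeta> unfolding visc_subdiff_real_iff by blast
  define t where "t = min d (min (x - a) (b - x)) / 2"
  have t: "t > 0" "t < d" "t < x - a" "t < b - x" using d(1) x by (auto simp: t_def)
  have "\<bar>f (x + h) - f x\<bar> \<le> L * \<bar>h\<bar>" if "\<bar>h\<bar> = t" for h
  proof -
    have "x + h \<in> {a..b}" "x \<in> {a..b}" using that t x by (auto simp: abs_if split: if_splits)
    then show ?thesis using lipschitz_onD[OF L, of "x + h" x] by (simp add: dist_real_def)
  qed
  from this[of t] this[of "- t"] have "\<zeta> * t \<le> (L + e) * t" "- \<zeta> * t \<le> (L + e) * t"
    using d(2)[of t] d(2)[of "- t"] t by (auto simp: algebra_simps)
  then have "\<zeta> \<le> L + e" "- \<zeta> \<le> L + e" using t(1) by (simp_all only: mult_le_cancel_right_pos)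
  then show "\<bar>\<zeta>\<bar> \<le> L + e" by auto
qed

text \<open>The barrier \<open>\<delta> / (x - a)\<close> keeps the minimiser of \<open>f - W\<close> away from the left end point,
  and its derivative makes the inequality strict.\<close>

lemma visc_subdiff_mean_value:
  fixes f W :: "real \<Rightarrow> real"
  assumes "a < b" and f: "continuous_on {a..b} f" and W: "continuous_on {a..b} W"
    and W': "\<And>x. a < x \<Longrightarrow> x < b \<Longrightarrow> (W has_real_derivative W' x) (at x)"
    and less: "W b - W a < f b - f a"
  obtains x \<zeta> where "a < x" "x < b" "\<zeta> \<in> visc_subdiff f x" "W' x < \<zeta>"
proof -
  define k where "k = (\<lambda>x. f x - W x)"
  have k: "continuous_on {a..b} k" unfolding k_def by (intro continuous_intros f W)
  have kab: "k a < k b" using less by (simp add: k_def)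
  obtain c where c: "a < c" "c < b" "k c < k b"
  proof -
    have "(k \<longlongrightarrow> k a) (at a within {a..b})"
      using k \<open>a < b\<close> by (simp add: continuous_on_def)
    then have "(k \<longlongrightarrow> k a) (at_right a)"
      using \<open>a < b\<close> by (simp add: at_within_Icc_at_right)
    then have "\<forall>\<^sub>F x in at_right a. k x < k b" by (rule order_tendstoD) (rule kab)
    moreover have "\<forall>\<^sub>F x in at_right a. a < x \<and> x < b"
      using \<open>a < b\<close> by (auto simp: eventually_at_right_field)
    ultimately have "\<forall>\<^sub>F x in at_right a. a < x \<and> x < b \<and> k x < k b" by eventually_elim auto
    then show ?thesis using that eventually_happens'[of "at_right a"] by force
  qed
  \<comment> \<open>With this \<open>\<delta>\<close> the barrier at \<open>c\<close> is half the
    gap \<open>k b - k c\<close>. The penalised value at \<open>c\<close> then stays below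
    \<open>k b\<close>, so \<open>b\<close> cannot be the minimiser.\<close>
  define \<delta> where "\<delta> = (k b - k c) * (c - a) / 2"
  have \<delta>: "\<delta> > 0" using c by (auto simp: \<delta>_def)
  define \<psi> where "\<psi> = (\<lambda>x. W x - \<delta> / (x - a))"
  have \<delta>c: "k c + \<delta> / (c - a) < k b"
  proof -
    have "\<delta> / (c - a) = (k b - k c) / 2" 
      using c(1) nonzero_mult_div_cancel_right[of "c - a" "(k b - k c) / 2"] unfolding \<delta>_def by simp
    then show ?thesis using c(3) by simp
  qed
  obtain B where B: "\<And>x. x \<in> {a..b} \<Longrightarrow> B \<le> k x" "B < k b"
  proof -
    obtain z where "\<forall>y\<in>{a..b}. k z \<le> k y"
      using continuous_attains_inf[OF compact_Icc _ k] \<open>a < b\<close> by auto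
    then have "k z - 1 \<le> k y" if "y \<in> {a..b}" for y using that by fastforce
    moreover have "k z \<le> k b" using \<open>\<forall>y\<in>{a..b}. k z \<le> k y\<close> \<open>a < b\<close> by auto
    ultimately show ?thesis using that[of "k z - 1"] by simp
  qed
  \<comment> \<open>The second bound makes the barrier at \<open>a + r\<close> at least
    \<open>k b - B\<close>, so the penalised value there is at least \<open>k b\<close>; the first
    keeps \<open>c\<close> in the interval as a competitor.\<close>
  define r where "r = min (c - a) (\<delta> / (k b - B))"
  have r: "r > 0" "r \<le> c - a" "r \<le> \<delta> / (k b - B)" using c \<delta> B by (auto simp: r_def)
  have "continuous_on {a + r..b} (\<lambda>x. k x + \<delta> / (x - a))"
    using r by (intro continuous_intros continuous_on_subset[OF k]) auto
  then obtain x where x: "x \<in> {a + r..b}"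
    and min: "\<And>y. y \<in> {a + r..b} \<Longrightarrow> k x + \<delta> / (x - a) \<le> k y + \<delta> / (y - a)"
  proof -
    have "{a + r..b} \<noteq> {}" using r c by auto
    then show ?thesis
      using continuous_attains_inf[OF compact_Icc _ \<open>continuous_on {a + r..b} _\<close>] that by blast
  qed
  have le: "k x + \<delta> / (x - a) \<le> k c + \<delta> / (c - a)" using min[of c] r c by auto
  have "\<delta> / (b - a) > 0" using \<delta> \<open>a < b\<close> by simp
  then have "x \<noteq> b" using le \<delta>c by auto
  moreover have "x \<noteq> a + r"
  proof
    assume "x = a + r"
    moreover have "\<delta> / r \<ge> k b - B"
      using r B \<delta> by (simp add: field_simps)
    ultimately show False using le \<delta>c B(1)[of x] x r by auto
  qed
  ultimately have x': "a + r < x" "x < b" using x by auto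
  \<comment> \<open>The minimiser is interior, and \<open>f - \<psi>\<close> is exactly the
    penalised function, so \<open>\<psi>\<close> serves as test function.\<close>
  have "\<delta> / (x - a)\<^sup>2 + W' x \<in> visc_subdiff f x"
  proof (rule DERIV_minorant_in_visc_subdiff)
    show "(\<psi> has_real_derivative \<delta> / (x - a)\<^sup>2 + W' x) (at x)"
      unfolding \<psi>_def using x' r
      by (auto intro!: derivative_eq_intros W' simp: power2_eq_square)
    show "min (x - (a + r)) (b - x) > 0" using x' by auto
    show "f x - \<psi> x \<le> f y - \<psi> y" if "\<bar>y - x\<bar> < min (x - (a + r)) (b - x)" for y
      using min[of y] that by (auto simp: k_def \<psi>_def abs_less_iff)
  qed
  then show ?thesis using that[of x "\<delta> / (x - a)\<^sup>2 + W' x"] x' r \<delta> by auto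
qed

section \<open>Subgradient bounds, growth, and the choice of slope\<close>

text \<open>Summing the Lipschitz constants on the intervals \<open>{0..n}\<close> gives a monotone
  step function \<open>c\<close>. Its average over \<open>{x + 1..x + 2}\<close> is continuous in
  \<open>x\<close> and, by monotonicity, at least \<open>c (x + 1)\<close>. The unit margin in
  \<open>y < x + 1\<close> lets one bound serve all points slightly to the right of
  \<open>x\<close>.\<close>

lemma local_lipschitz_subgradient_majorant:
  fixes V :: "real \<Rightarrow> real"
  assumes "locally_lipschitz V"
  obtains \<phi> where "continuous_on {0..} \<phi>"
    "\<And>x y \<zeta>. 0 < y \<Longrightarrow> y < x + 1 \<Longrightarrow> 0 \<le> x \<Longrightarrow> \<zeta> \<in> visc_subdiff V y \<Longrightarrow> \<bar>\<zeta>\<bar> \<le> \<phi> x"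
proof -
  have "\<exists>L. L-lipschitz_on {0..real n} V" for n
    using local_lipschitz_compact_implies_lipschitz[of "{0::real}" "{0..real n}" "\<lambda>_. V"]
      local_lipschitz_subset[OF assms[unfolded locally_lipschitz_def], of "{0}" "{0..real n}"]
    by (metis compact_Icc compact_sing continuous_on_const insertI1 subset_UNIV)
  then obtain L where L: "\<And>n. (L n)-lipschitz_on {0..real n} V" by metis
  have L0: "L n \<ge> 0" for n using L lipschitz_on_nonneg by blast
  define c where "c = (\<lambda>x::real. \<Sum>k\<le>nat \<lceil>x\<rceil>. L k)"
  have mono: "mono c"
    unfolding c_def
    by (intro monoI sum_mono2) (auto simp: L0 simp del: nat_ceiling_le_eq intro!: nat_mono ceiling_mono)
  have int: "c integrable_on {u..v}" for u v
    by (intro integrable_on_mono_on) (meson mono monoD mono_onI)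
  define I where "I = (\<lambda>u. integral {0..u} c)"
  define \<phi> where "\<phi> = (\<lambda>x. I (x + 2) - I (x + 1))"
  \<comment> \<open>For \<open>x > - 1\<close> both arguments of \<open>I\<close> are positive;
    starting below 0 gives two-sided continuity at 0 as well.\<close>
  have "isCont \<phi> x" if "x > - 1" for x
  proof -
    have I: "continuous_on {0..x + 4} I"
      unfolding I_def by (rule indefinite_integral_continuous_1[OF int])
    have "continuous_on {- 1<..<x + 1} \<phi>"
      unfolding \<phi>_def by (intro continuous_intros continuous_on_compose2[OF I]) auto
    then show ?thesis using that by (simp add: continuous_on_eq_continuous_at)
  qed
  then have "continuous_on {0..} \<phi>"
    by (intro continuous_at_imp_continuous_on) auto
  moreover have "\<bar>\<zeta>\<bar> \<le> \<phi> x" if "0 < y" "y < x + 1" "0 \<le> x" "\<zeta> \<in> visc_subdiff V y" for x y \<zeta>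
  proof -
    \<comment> \<open>Since \<open>y < x + 1 \<le> n\<close>, the point \<open>y\<close> is interior
      to \<open>{0..n}\<close>, and \<open>L n\<close> is a summand of
      \<open>c (x + 1)\<close>.\<close>
    define n where "n = nat \<lceil>x + 1\<rceil>"
    have "\<bar>\<zeta>\<bar> \<le> L n"
    proof (rule visc_subdiff_lipschitz_bound[OF L])
      show "y < real n" using that real_nat_ceiling_ge[of "x + 1"] unfolding n_def by linarith
    qed (use that in auto)
    also have "L n \<le> c (x + 1)"
      unfolding c_def n_def by (rule member_le_sum) (auto simp: L0)
    also have "\<dots> = integral {x + 1..x + 2} (\<lambda>_. c (x + 1))" by simp
    also have "\<dots> \<le> integral {x + 1..x + 2} c"
      by (intro integral_le int) (auto intro: monoD[OF mono])
    also have "\<dots> = \<phi> x"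
      using Henstock_Kurzweil_Integration.integral_combine[OF _ _ int, of 0 "x + 1" "x + 2"] that(3)
      by (simp add: \<phi>_def I_def)
    finally show ?thesis .
  qed
  ultimately show ?thesis by (rule that)
qed

lemma proper_fun_gt:
  fixes V :: "real \<Rightarrow> real"
  assumes "proper_fun V"
  obtains R where "\<And>x. x > R \<Longrightarrow> B < V x"
proof -
  \<comment> \<open>Properness speaks of positive levels only, hence the maximum with 1.\<close>
  have "bounded {x. V x \<le> max 1 B}"
    using assms by (intro compact_imp_bounded) (auto simp: proper_fun_def)
  then obtain R where "\<And>x. V x \<le> max 1 B \<Longrightarrow> \<bar>x\<bar> \<le> R"
    by (auto simp: bounded_iff)
  then show ?thesis
    by (intro that[of R]) (meson abs_ge_self linorder_not_less max.coboundedI2 order.strict_trans2)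
qed

text \<open>Here \<open>e\<close> is the larger root of \<open>t\<^sup>2 - b t + G c\<close>, so that
  \<open>G p\<^sup>2 - b p + c = (G p - e) (p - c / e)\<close>; the chosen \<open>p\<close> is the minimum of \<open>\<phi>\<close> and the larger
  root \<open>e / G\<close>, written so that it stays continuous where \<open>G\<close> vanishes.\<close>

lemma quadratic_selection:
  fixes G b c \<zeta> \<phi> :: real
  assumes "G \<ge> 0" "b > 0" "c > 0" and H: "G * \<zeta>\<^sup>2 - b * \<zeta> + c \<le> 0" and "\<zeta> \<le> \<phi>"
  defines "e \<equiv> (b + sqrt (b\<^sup>2 - 4 * G * c)) / 2"
  defines "p \<equiv> \<phi> * e / max e (G * \<phi>)"
  shows "e > 0" "\<zeta> > 0" "\<zeta> \<le> p" "p \<le> \<phi>" "G * p\<^sup>2 - b * p + c \<le> 0"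
proof -
  \<comment> \<open>The factor \<open>4 * G\<close> completes the square, so the solution
    \<open>\<zeta>\<close> forces a nonnegative discriminant.\<close>
  have "4 * G * (G * \<zeta>\<^sup>2 - b * \<zeta> + c) \<le> 0"
    using H \<open>G \<ge> 0\<close> by (simp add: mult_nonneg_nonpos)
  then have sq: "(2 * G * \<zeta> - b)\<^sup>2 \<le> b\<^sup>2 - 4 * G * c"
    by (simp add: power2_eq_square algebra_simps)
  then have D: "b\<^sup>2 - 4 * G * c \<ge> 0" using zero_le_power2 order_trans by blast
  show e: "e > 0" using D \<open>b > 0\<close> unfolding e_def by (simp add: add_pos_nonneg)
  have "2 * e - b = sqrt (b\<^sup>2 - 4 * G * c)"
    unfolding e_def by (simp add: field_simps del: distrib_left_numeral)
  then have "(2 * e - b)\<^sup>2 = b\<^sup>2 - 4 * G * c" using D by simp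
  then have root: "G * c = e * (b - e)" by (simp add: power2_eq_square algebra_simps)
  have "b * \<zeta> > 0" using H \<open>c > 0\<close> mult_nonneg_nonneg[OF \<open>G \<ge> 0\<close> zero_le_power2[of \<zeta>]] by linarith
  then show \<zeta>: "\<zeta> > 0" using \<open>b > 0\<close> by (simp add: zero_less_mult_iff)
  have G\<zeta>: "G * \<zeta> \<le> e"
    using real_le_rsqrt[OF sq] by (simp add: e_def)
  have \<phi>: "\<phi> > 0" using \<zeta> \<open>\<zeta> \<le> \<phi>\<close> by simp
  have m: "max e (G * \<phi>) > 0" using e by auto
  show "p \<le> \<phi>" using e \<phi> m by (simp add: p_def field_simps)
  have "\<zeta> * (G * \<phi>) \<le> \<phi> * e" using G\<zeta> \<phi> by (simp add: algebra_simps)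
  moreover have "\<zeta> * e \<le> \<phi> * e" using e \<open>\<zeta> \<le> \<phi>\<close> by simp
  ultimately show p: "\<zeta> \<le> p"
    using m by (simp add: p_def field_simps max_def)
  have "G * \<phi> * e \<le> max e (G * \<phi>) * e" using e by (intro mult_right_mono) auto
  then have Gp: "G * p \<le> e" using m by (simp add: p_def field_simps)
  have fac: "e * (G * q\<^sup>2 - b * q + c) = (G * q - e) * (e * q - c)" for q
    using root by (simp add: power2_eq_square algebra_simps) algebra
  show "G * p\<^sup>2 - b * p + c \<le> 0"
  \<comment> \<open>If \<open>\<zeta>\<close> is the larger root, \<open>p\<close> is squeezed onto
    it. Otherwise the first factor is negative at \<open>\<zeta>\<close>, so the second is
    nonnegative there and remains so at the larger \<open>p\<close>.\<close>
  proof (cases "G * \<zeta> = e")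
    case True
    then have "G > 0" using e \<open>G \<ge> 0\<close> by (cases "G = 0") auto
    then have "p = \<zeta>" using Gp p True by (metis antisym mult_le_cancel_left_pos)
    then show ?thesis using H by simp
  next
    case False
    have "(G * \<zeta> - e) * (e * \<zeta> - c) \<le> 0"
      unfolding fac[symmetric] using e H by (simp add: mult_nonneg_nonpos)
    then have "e * \<zeta> \<ge> c" using False G\<zeta> by (auto simp: mult_le_0_iff)
    moreover have "e * \<zeta> \<le> e * p" using p e by simp
    ultimately have "(G * p - e) * (e * p - c) \<le> 0" using Gp by (auto simp: mult_le_0_iff)
    then show ?thesis unfolding fac[symmetric] using e by (simp add: mult_le_0_iff)
  qed
qed

section \<open>The storage function on a half-line\<close>

text \<open>\<open>p\<close> may have no limit at 0, but being bounded and continuous on the open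
  interval it is integrable up to 0, whatever its value there. The integral from 0 is therefore
  continuous at 0.\<close>

lemma primitive_of_locally_bounded:
  fixes p :: "real \<Rightarrow> real"
  assumes p: "continuous_on {0<..} p" and pos: "\<And>x. 0 < x \<Longrightarrow> 0 < p x"
    and M: "\<And>x. 0 < x \<Longrightarrow> x \<le> 1 \<Longrightarrow> p x \<le> M"
  obtains W where "continuous_on {0..} W" "W 0 = 0" "\<And>x. 0 < x \<Longrightarrow> 0 < W x"
    "\<And>x. 0 < x \<Longrightarrow> (W has_real_derivative p x) (at x)"
proof -
  have int1: "p integrable_on {0..1}"
  proof -
    have "p integrable_on {0<..<1}"
    proof (rule measurable_bounded_by_integrable_imp_integrable)
      show "p \<in> borel_measurable (lebesgue_on {0<..<1})"
        by (intro continuous_imp_measurable_on_sets_lebesgue continuous_on_subset[OF p]) auto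
      show "(\<lambda>_. M) integrable_on {0<..<1::real}"
        using integrable_const_ivl[of M "0::real" 1] by (simp only: integrable_on_Icc_iff_Ioo)
      show "norm (p x) \<le> M" if "x \<in> {0<..<1}" for x using that pos[of x] M[of x] by auto
    qed auto
    then show ?thesis using integrable_on_Icc_iff_Ioo by blast
  qed
  have int: "p integrable_on {0..b}" for b
  proof (cases "b \<le> 1")
    case True
    then show ?thesis by (intro integrable_on_subinterval[OF int1]) auto
  next
    case False
    have "p integrable_on {1..b}"
      by (intro integrable_continuous_interval continuous_on_subset[OF p]) auto
    then show ?thesis using False Henstock_Kurzweil_Integration.integrable_combine[OF _ _ int1] by auto
  qed
  define W where "W = (\<lambda>x. integral {0..x} p)"
  have I: "continuous_on {0..b} W" for b
    unfolding W_def by (rule indefinite_integral_continuous_1[OF int])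
  have der: "(W has_real_derivative p x) (at x)" if "0 < x" for x
  proof -
    have "continuous (at x within {0..x + 1} - {}) p"
      using p that by (simp add: continuous_on_eq_continuous_at continuous_at_imp_continuous_at_within)
    from integral_has_vector_derivative_continuous_at[OF int _ _ this] that
    have "(W has_vector_derivative p x) (at x within {0..x + 1})" by (simp add: W_def)
    moreover have "at x within {0..x + 1} = at x" using that by (intro at_within_Icc_at) auto
    ultimately show ?thesis by (simp add: has_real_derivative_iff_has_vector_derivative)
  qed
  have W0: "W 0 = 0" by (simp add: W_def)
  have "0 < W x" if "0 < x" for x
    using DERIV_pos_imp_increasing_open[of 0 x W] der pos that I[of x] W0 by fastforce
  \<comment> \<open>Positive points are covered by the derivative; at 0 the filters within
    \<open>{0..}\<close> and \<open>{0..1}\<close> coincide.\<close>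
  moreover have "continuous_on {0..} W"
  proof -
    have "continuous_on {0<..} W"
      using der DERIV_isCont by (fastforce intro: continuous_at_imp_continuous_on)
    moreover have "continuous (at 0 within {0..}) W"
    proof -
      have "continuous (at 0 within {0..1}) W" using I[of 1] by (simp add: continuous_on_eq_continuous_within)
      moreover have "at (0::real) within {0..} = at 0 within {0..1}"
        by (simp add: at_within_Icc_at_right at_within_Ici_at_right)
      ultimately show ?thesis by simp
    qed
    ultimately show ?thesis
      unfolding continuous_on_eq_continuous_within
      by (metis DERIV_isCont atLeast_iff continuous_at_imp_continuous_at_within der less_eq_real_def)
  qed
  ultimately show ?thesis using that W0 der by blast
qed

text \<open>\<open>V\<close> may have no subgradient at \<open>x\<close> itself. Subgradients at
  points tending to \<open>x\<close> from the right lie in the compact interval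
  \<open>{- \<phi> x..\<phi> x}\<close>; along a convergent subsequence the inequality passes to the
  limit.\<close>

lemma subgradient_inequality_pointwise:
  fixes V a G \<phi> :: "real \<Rightarrow> real"
  assumes V: "continuous_on UNIV V" and a: "continuous_on {0<..} a" and G: "continuous_on {0<..} G"
    and \<phi>: "\<And>x y \<zeta>. 0 < y \<Longrightarrow> y < x + 1 \<Longrightarrow> 0 \<le> x \<Longrightarrow> \<zeta> \<in> visc_subdiff V y \<Longrightarrow> \<bar>\<zeta>\<bar> \<le> \<phi> x"
    and H: "\<And>x \<zeta>. 0 < x \<Longrightarrow> \<zeta> \<in> visc_subdiff V x \<Longrightarrow> G x * \<zeta>\<^sup>2 + a x * \<zeta> + x\<^sup>2 \<le> 0"
    and "0 < x"
  obtains \<zeta> where "\<bar>\<zeta>\<bar> \<le> \<phi> x" "G x * \<zeta>\<^sup>2 + a x * \<zeta> + x\<^sup>2 \<le> 0"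
proof -
  have "\<exists>y \<zeta>. x < y \<and> y < x + 1 / Suc n \<and> \<zeta> \<in> visc_subdiff V y" for n
  proof -
    let ?b = "x + 1 / Suc n"
    \<comment> \<open>The line with slope \<open>K\<close>, one less than the difference quotient,
      satisfies the strict hypothesis of the mean value lemma; only the existence of a subgradient
      is kept.\<close>
    define K where "K = (V ?b - V x) * Suc n - 1"
    have "K * ?b - K * x < V ?b - V x" by (simp add: K_def field_simps)
    then obtain y \<zeta> where "x < y" "y < ?b" "\<zeta> \<in> visc_subdiff V y"
      by (rule visc_subdiff_mean_value[of x ?b V "\<lambda>y. K * y" "\<lambda>_. K", rotated 4])
        (auto intro!: continuous_intros derivative_eq_intros continuous_on_subset[OF V])
    then show ?thesis by blast
  qed
  then obtain y z where yz: "\<And>n. x < y n" "\<And>n. y n < x + 1 / Suc n" "\<And>n. z n \<in> visc_subdiff V (y n)"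
    by metis
  have yx: "y n < x + 1" for n
    using yz(2)[of n] by (rule order.strict_trans2) (simp add: field_simps)
  have z: "z n \<in> {- \<phi> x..\<phi> x}" for n
    using \<phi>[of "y n" x "z n"] yz(1,3)[of n] yx[of n] \<open>0 < x\<close> by auto
  then obtain \<zeta> r where \<zeta>: "\<zeta> \<in> {- \<phi> x..\<phi> x}" and r: "strict_mono r" "(z \<circ> r) \<longlonglongrightarrow> \<zeta>"
    using compact_imp_seq_compact[OF compact_Icc, of "- \<phi> x" "\<phi> x"] by (metis seq_compactE)
  have "y \<longlonglongrightarrow> x"
  proof (rule tendsto_sandwich[of "\<lambda>_. x" _ _ "\<lambda>n. x + 1 / Suc n"])
    show "(\<lambda>n. x + 1 / Suc n) \<longlonglongrightarrow> x"
      using tendsto_add[OF tendsto_const LIMSEQ_Suc[OF lim_1_over_n]] by force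
  qed (use yz(1,2) in \<open>simp_all add: less_imp_le\<close>)
  then have y: "(y \<circ> r) \<longlonglongrightarrow> x" using r(1) by (rule LIMSEQ_subseq_LIMSEQ)
  have "isCont a x" "isCont G x" using a G \<open>0 < x\<close> by (auto simp: continuous_on_eq_continuous_at)
  then have "(\<lambda>n. a ((y \<circ> r) n)) \<longlonglongrightarrow> a x" "(\<lambda>n. G ((y \<circ> r) n)) \<longlonglongrightarrow> G x"
    using isCont_tendsto_compose y by blast+
  then have "(\<lambda>n. G ((y \<circ> r) n) * ((z \<circ> r) n)\<^sup>2 + a ((y \<circ> r) n) * (z \<circ> r) n + ((y \<circ> r) n)\<^sup>2)
      \<longlonglongrightarrow> G x * \<zeta>\<^sup>2 + a x * \<zeta> + x\<^sup>2"
    by (intro tendsto_intros r y)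
  moreover have "G ((y \<circ> r) n) * ((z \<circ> r) n)\<^sup>2 + a ((y \<circ> r) n) * (z \<circ> r) n + ((y \<circ> r) n)\<^sup>2 \<le> 0" for n
    using H[of "y (r n)" "z (r n)"] yz \<open>0 < x\<close> by (simp add: order.strict_trans)
  ultimately have "G x * \<zeta>\<^sup>2 + a x * \<zeta> + x\<^sup>2 \<le> 0"
    by (intro LIMSEQ_le_const2) auto
  moreover have "\<bar>\<zeta>\<bar> \<le> \<phi> x" using \<zeta> by auto
  ultimately show ?thesis by (rule that[rotated])
qed

text \<open>General coefficients \<open>a\<close> and \<open>G\<close> allow use for the system and
  for its reflection. Positivity of the slope makes \<open>W\<close> positive, and its domination of
  the subgradients of \<open>V\<close> carries properness over to \<open>W\<close>.\<close>

lemma half_line_storage: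
  fixes V a G :: "real \<Rightarrow> real"
  assumes V: "continuous_on UNIV V" "locally_lipschitz V" "proper_fun V"
    and a: "continuous_on {0<..} a" and G: "continuous_on {0<..} G" and G0: "\<And>x. 0 < x \<Longrightarrow> 0 \<le> G x"
    and H: "\<And>x \<zeta>. 0 < x \<Longrightarrow> \<zeta> \<in> visc_subdiff V x \<Longrightarrow> G x * \<zeta>\<^sup>2 + a x * \<zeta> + x\<^sup>2 \<le> 0"
  obtains W p where "continuous_on {0..} W" "W 0 = 0" "\<And>x. 0 < x \<Longrightarrow> 0 < W x"
    "\<And>x. 0 < x \<Longrightarrow> (W has_real_derivative p x) (at x)" "continuous_on {0<..} p"
    "\<And>x. 0 < x \<Longrightarrow> G x * (p x)\<^sup>2 + a x * p x + x\<^sup>2 \<le> 0"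
    "\<And>B. \<exists>R. \<forall>x>R. B < W x"
proof -
  obtain \<phi> where \<phi>c: "continuous_on {0..} \<phi>" and
    \<phi>: "\<And>x y \<zeta>. 0 < y \<Longrightarrow> y < x + 1 \<Longrightarrow> 0 \<le> x \<Longrightarrow> \<zeta> \<in> visc_subdiff V y \<Longrightarrow> \<bar>\<zeta>\<bar> \<le> \<phi> x"
    using local_lipschitz_subgradient_majorant[OF V(2)] by blast
  have ex: "\<exists>\<zeta>. \<bar>\<zeta>\<bar> \<le> \<phi> x \<and> G x * \<zeta>\<^sup>2 + a x * \<zeta> + x\<^sup>2 \<le> 0" if "0 < x" for x
    by (rule subgradient_inequality_pointwise[of V a G \<phi> x]) (use V(1) a G \<phi> H that in blast)+
  have GS: "0 \<le> G x * \<zeta>\<^sup>2" if "0 < x" for x \<zeta> using G0[OF that] by simp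
  \<comment> \<open>With a vanishing linear term the left side would be at least the positive square
    of \<open>x\<close>.\<close>
  have a0: "a x \<noteq> 0" if "0 < x" for x
  proof
    assume "a x = 0"
    then show False using ex[OF that] GS[OF that] that
      by (metis add_nonneg_pos linorder_not_less mult_zero_left add.right_neutral zero_less_power)
  qed
  \<comment> \<open>Otherwise \<open>a\<close> would be positive on the whole half-line by
    connectedness, which excludes positive subgradients; but \<open>V\<close> exceeds
    \<open>V 1\<close> far out, and comparison with a constant yields one.\<close>
  have aneg: "a x < 0" if "0 < x" for x
  proof (rule ccontr)
    assume "\<not> a x < 0"
    have apos: "0 < a y" if "0 < y" for y
    proof (rule ccontr)
      assume "\<not> 0 < a y"
      then have "0 \<in> a ` {0<..}"
        using connectedD_interval[OF connected_continuous_image[OF a connected_Ioi], of "a y" "a x" 0]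
          \<open>0 < x\<close> \<open>0 < y\<close> \<open>\<not> a x < 0\<close> by auto
      then show False using a0 by auto
    qed
    obtain R where R: "\<And>y. R < y \<Longrightarrow> V 1 < V y" using proper_fun_gt[OF V(3), of "V 1"] by blast
    define b where "b = max R 1 + 1"
    have b: "1 < b" "V 1 < V b" using R[of b] by (auto simp: b_def)
    obtain y \<zeta> where y: "1 < y" "y < b" "\<zeta> \<in> visc_subdiff V y" "0 < \<zeta>"
      by (rule visc_subdiff_mean_value[of 1 b V "\<lambda>_. 0" "\<lambda>_. 0"])
        (use b continuous_on_subset[OF V(1)] in auto)
    have "0 < a y * \<zeta>" "0 < y\<^sup>2" using y apos[of y] by auto
    then show False using H[of y \<zeta>] GS[of y \<zeta>] y by linarith
  qed
  define e where "e = (\<lambda>x. (- a x + sqrt ((- a x)\<^sup>2 - 4 * G x * x\<^sup>2)) / 2)"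
  define p where "p = (\<lambda>x. \<phi> x * e x / max (e x) (G x * \<phi> x))"
  \<comment> \<open>\<open>e\<close> and \<open>p\<close> do not depend on \<open>\<zeta>\<close>: a
    single solution below \<open>\<phi> x\<close> settles sign and inequality, while ranging over
    the subgradients of \<open>V\<close> gives domination.\<close>
  have sel: "0 < e x" "0 < \<zeta>" "\<zeta> \<le> p x" "p x \<le> \<phi> x" "G x * (p x)\<^sup>2 + a x * p x + x\<^sup>2 \<le> 0"
    if "0 < x" "\<zeta> \<le> \<phi> x" "G x * \<zeta>\<^sup>2 + a x * \<zeta> + x\<^sup>2 \<le> 0" for x \<zeta>
  proof -
    have "0 \<le> G x" "0 < - a x" "0 < x\<^sup>2" "G x * \<zeta>\<^sup>2 - - a x * \<zeta> + x\<^sup>2 \<le> 0"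
      using G0 aneg that by simp_all
    from quadratic_selection[OF this that(2)]
    show "0 < e x" "0 < \<zeta>" "\<zeta> \<le> p x" "p x \<le> \<phi> x" "G x * (p x)\<^sup>2 + a x * p x + x\<^sup>2 \<le> 0"
      unfolding e_def p_def by simp_all
  qed
  have e: "0 < e x" and p0: "0 < p x" and p\<phi>: "p x \<le> \<phi> x"
    and pH: "G x * (p x)\<^sup>2 + a x * p x + x\<^sup>2 \<le> 0" if "0 < x" for x
  proof -
    obtain \<zeta> where "\<zeta> \<le> \<phi> x" "G x * \<zeta>\<^sup>2 + a x * \<zeta> + x\<^sup>2 \<le> 0"
      using ex[OF \<open>0 < x\<close>] by (auto simp: abs_le_iff)
    note * = sel[OF \<open>0 < x\<close> this]
    show "0 < e x" "p x \<le> \<phi> x" "G x * (p x)\<^sup>2 + a x * p x + x\<^sup>2 \<le> 0"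
      by (fact *)+
    show "0 < p x" using *(2,3) by (rule order.strict_trans2)
  qed
  have pV: "\<zeta> \<le> p x" if "0 < x" "\<zeta> \<in> visc_subdiff V x" for x \<zeta>
  proof (rule sel(3)[OF that(1) _ H[OF that]])
    show "\<zeta> \<le> \<phi> x" using \<phi>[of x x \<zeta>] that by simp
  qed
  have pc: "continuous_on {0<..} p"
  proof -
    have "max (e x) (G x * \<phi> x) \<noteq> 0" if "0 < x" for x using e[OF that] by auto
    then show ?thesis
      unfolding p_def e_def
      by (intro continuous_intros a G continuous_on_subset[OF \<phi>c]) (auto simp: e_def)
  qed
  obtain M where M: "\<And>x. x \<in> {0..1} \<Longrightarrow> \<phi> x \<le> M"
  proof -
    have "continuous_on {0..1} \<phi>" by (rule continuous_on_subset[OF \<phi>c]) auto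
    then show ?thesis
      using continuous_attains_sup[OF compact_Icc, of 0 1 \<phi>] that by (metis atLeastatMost_empty_iff zero_le_one)
  qed
  \<comment> \<open>The cap \<open>\<phi>\<close> is continuous up to 0, so \<open>p\<close> stays
    bounded there even where the larger root of the quadratic is not.\<close>
  have pM: "p x \<le> M" if "0 < x" "x \<le> 1" for x
    using p\<phi>[OF that(1)] M[of x] that by simp
  obtain W where W: "continuous_on {0..} W" "W 0 = 0" "\<And>x. 0 < x \<Longrightarrow> 0 < W x"
    "\<And>x. 0 < x \<Longrightarrow> (W has_real_derivative p x) (at x)"
    using primitive_of_locally_bounded[OF pc p0 pM] by blast
  \<comment> \<open>If \<open>V\<close> outgrew \<open>W\<close> from 1 to \<open>x\<close>, the
    mean value lemma would give a subgradient larger than \<open>p\<close>.\<close>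
  have le: "V x - V 1 \<le> W x - W 1" if "1 < x" for x
  proof (rule ccontr)
    assume "\<not> ?thesis"
    then have less: "W x - W 1 < V x - V 1" by simp
    obtain y \<zeta> where "1 < y" "\<zeta> \<in> visc_subdiff V y" "p y < \<zeta>"
    proof (rule visc_subdiff_mean_value[OF \<open>1 < x\<close> _ _ _ less])
      show "continuous_on {1..x} V" "continuous_on {1..x} W"
        by (auto intro: continuous_on_subset[OF V(1)] continuous_on_subset[OF W(1)])
      show "(W has_real_derivative p y) (at y)" if "1 < y" for y
        using W(4) that by simp
    qed
    then show False using pV[of y \<zeta>] by auto
  qed
  have "\<exists>R. \<forall>x>R. B < W x" for B
  proof -
    obtain R where "\<And>x. R < x \<Longrightarrow> B - W 1 + V 1 < V x"
      using proper_fun_gt[OF V(3), of "B - W 1 + V 1"] by blast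
    then have "\<forall>x>max R 1. B < W x" using le by (smt (verit))
    then show ?thesis by blast
  qed
  from that[OF W pc pH this] show ?thesis .
qed

section \<open>Reflection of the state and the worst-case input\<close>

lemma visc_subdiff_reflect:
  fixes V :: "real \<Rightarrow> real"
  assumes "\<zeta> \<in> visc_subdiff (\<lambda>x. V (- x)) x"
  shows "- \<zeta> \<in> visc_subdiff V (- x)"
  unfolding visc_subdiff_real_iff
proof (intro allI impI)
  fix e :: real assume "e > 0"
  then obtain d where d: "d > 0" "\<And>h. \<bar>h\<bar> < d \<Longrightarrow> V (- (x + h)) - V (- x) - \<zeta> * h \<ge> - e * \<bar>h\<bar>"
    using assms unfolding visc_subdiff_real_iff by blast
  have "V (- x + h) - V (- x) - - \<zeta> * h \<ge> - e * \<bar>h\<bar>" if "\<bar>h\<bar> < d" for h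
    using d(2)[of "- h"] that by simp
  then show "\<exists>d>0. \<forall>h. \<bar>h\<bar> < d \<longrightarrow> V (- x + h) - V (- x) - - \<zeta> * h \<ge> - e * \<bar>h\<bar>"
    using d(1) by blast
qed

lemma locally_lipschitz_reflect:
  fixes V :: "real \<Rightarrow> real"
  assumes "locally_lipschitz V"
  shows "locally_lipschitz (\<lambda>x. V (- x))"
  unfolding locally_lipschitz_def
proof (rule local_lipschitzI)
  fix t x :: real
  obtain u L where u: "u > 0" and L: "\<And>s::real. s \<in> cball t u \<inter> UNIV \<Longrightarrow> L-lipschitz_on (cball (- x) u \<inter> UNIV) V"
    using local_lipschitzE[OF assms[unfolded locally_lipschitz_def], of t "- x"] by auto
  have "L-lipschitz_on (cball (- x) u) V" using L[of t] u by simp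
  then have "L-lipschitz_on (cball x u) (\<lambda>x. V (- x))"
    unfolding lipschitz_on_def
  proof (intro conjI ballI; elim conjE)
    fix y z
    assume *: "\<forall>v\<in>cball (- x) u. \<forall>w\<in>cball (- x) u. dist (V v) (V w) \<le> L * dist v w"
      and "y \<in> cball x u" "z \<in> cball x u"
    then have "- y \<in> cball (- x) u" "- z \<in> cball (- x) u" by (auto simp: dist_minus)
    then have "dist (V (- y)) (V (- z)) \<le> L * dist (- y) (- z)" using * by blast
    then show "dist (V (- y)) (V (- z)) \<le> L * dist y z" by (simp add: dist_minus)
  qed
  then show "\<exists>u>0. \<exists>L. \<forall>s\<in>cball t u \<inter> UNIV. L-lipschitz_on (cball x u \<inter> UNIV) (\<lambda>x. V (- x))"
    using u by auto
qed

lemma proper_fun_reflect: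
  fixes V :: "real \<Rightarrow> real"
  assumes "proper_fun V"
  shows "proper_fun (\<lambda>x. V (- x))"
proof -
  have "{x. V (- x) \<le> a} = uminus ` {x. V x \<le> a}" for a
    by (auto intro: image_eqI[of _ _ "- _"])
  then show ?thesis using assms by (auto simp: proper_fun_def intro: compact_negations)
qed

text \<open>Completing the square in \<open>u\<close>: the worst input is \<open>u\<^sub>i = p g\<^sub>i(x) / (2 \<gamma>)\<close>.\<close>

lemma affine_system_dissipation_iff:
  fixes g :: "'m::finite \<Rightarrow> real \<Rightarrow> real"
  assumes "\<gamma> > 0"
  shows "(\<forall>u. p * affine_system g0 g x u \<le> - x\<^sup>2 + \<gamma> * (norm u)\<^sup>2) \<longleftrightarrow>
    (\<Sum>i\<in>UNIV. (g i x)\<^sup>2 / (4 * \<gamma>)) * p\<^sup>2 + g0 x * p + x\<^sup>2 \<le> 0"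
proof -
  have norm: "(norm u)\<^sup>2 = (\<Sum>i\<in>UNIV. (u $ i)\<^sup>2)" for u :: "real ^ 'm"
    
    unfolding power2_norm_eq_inner by (simp add: inner_vec_def power2_eq_square)
  define s where "s = (\<lambda>u::real ^ 'm. \<Sum>i\<in>UNIV. \<gamma> * (u $ i - p * g i x / (2 * \<gamma>))\<^sup>2)"
  have "s u = (\<Sum>i\<in>UNIV. \<gamma> * (u $ i)\<^sup>2 - p * (u $ i * g i x) + (g i x)\<^sup>2 / (4 * \<gamma>) * p\<^sup>2)" for u
    unfolding s_def using assms by (intro sum.cong) (auto simp: power2_eq_square field_simps)
  then have "s u = \<gamma> * (norm u)\<^sup>2 - p * (\<Sum>i\<in>UNIV. u $ i * g i x)
      + (\<Sum>i\<in>UNIV. (g i x)\<^sup>2 / (4 * \<gamma>)) * p\<^sup>2" for u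
    by (simp add: norm sum.distrib sum_subtractf sum_distrib_left sum_distrib_right)
  then have eq: "p * affine_system g0 g x u + x\<^sup>2 - \<gamma> * (norm u)\<^sup>2 =
      (\<Sum>i\<in>UNIV. (g i x)\<^sup>2 / (4 * \<gamma>)) * p\<^sup>2 + g0 x * p + x\<^sup>2 - s u" for u
    by (simp add: affine_system_def algebra_simps)
  have "s u \<ge> 0" for u unfolding s_def using assms by (intro sum_nonneg) auto
  moreover have "s (\<chi> i. p * g i x / (2 * \<gamma>)) = 0" by (simp add: s_def)
  ultimately show ?thesis using eq by (smt (verit))
qed

section \<open>Gluing the two half-lines\<close>

text \<open>The pieces agree at 0, and \<open>C1_0\<close> asks for no derivative there. On the
  negative side the slope is \<open>- p2 (- x)\<close>, whose sign cancels that of the reflected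
  drift in the quadratic inequality.\<close>

lemma glue_half_line_storages:
  fixes g :: "'m::finite \<Rightarrow> real \<Rightarrow> real"
  assumes "\<gamma> > 0"
  defines "G \<equiv> \<lambda>x. \<Sum>i\<in>UNIV. (g i x)\<^sup>2 / (4 * \<gamma>)"
  assumes W1: "continuous_on {0..} W1" "W1 0 = 0" "\<And>x. 0 < x \<Longrightarrow> 0 < W1 x"
    "\<And>x. 0 < x \<Longrightarrow> (W1 has_real_derivative p1 x) (at x)" "continuous_on {0<..} p1"
    "\<And>x. 0 < x \<Longrightarrow> G x * (p1 x)\<^sup>2 + g0 x * p1 x + x\<^sup>2 \<le> 0"
    "\<And>B. \<exists>R. \<forall>x>R. B < W1 x"
  assumes W2: "continuous_on {0..} W2" "W2 0 = 0" "\<And>x. 0 < x \<Longrightarrow> 0 < W2 x"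
    "\<And>x. 0 < x \<Longrightarrow> (W2 has_real_derivative p2 x) (at x)" "continuous_on {0<..} p2"
    "\<And>x. 0 < x \<Longrightarrow> G (- x) * (p2 x)\<^sup>2 + - g0 (- x) * p2 x + x\<^sup>2 \<le> 0"
    "\<And>B. \<exists>R. \<forall>x>R. B < W2 x"
  shows "(\<lambda>x. if 0 \<le> x then W1 x else W2 (- x)) \<in> storage_W_inf (affine_system g0 g) UNIV \<gamma> \<inter> C1_0"
proof -
  define W where "W = (\<lambda>x. if 0 \<le> x then W1 x else W2 (- x))"
  define p where "p = (\<lambda>x. if 0 \<le> x then p1 x else - p2 (- x))"
  have cont: "continuous_on UNIV W"
  proof -
    have "continuous_on ({0..} \<union> {..0}) W"
      unfolding W_def
      by (rule continuous_on_If)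
        (auto simp: W1(2) W2(2) intro!: W1(1) continuous_on_compose2[OF W2(1)] continuous_intros)
    moreover have "{0..} \<union> {..0::real} = UNIV" by auto
    ultimately show ?thesis by simp
  qed
  have pos: "W x > 0" if "x \<noteq> 0" for x using W1(3) W2(3) that by (auto simp: W_def)
  have W0: "W 0 = 0" by (simp add: W_def W1(2))
  have der: "(W has_real_derivative p x) (at x)" if "x \<noteq> 0" for x
  proof (cases "x > 0")
    case True
    have "(W1 has_real_derivative p x) (at x)" using W1(4)[OF True] True by (simp add: p_def)
    then show ?thesis
      by (rule has_field_derivative_transform_within_open[of _ _ _ "{0<..}"])
        (use True in \<open>auto simp: W_def\<close>)
  next
    case False
    then have x: "x < 0" using that by simp
    have "((\<lambda>x. W2 (- x)) has_real_derivative p x) (at x)"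
      using DERIV_chain'[OF DERIV_minus[OF DERIV_ident] W2(4)[of "- x"]] x by (simp add: p_def)
    then show ?thesis
      by (rule has_field_derivative_transform_within_open[of _ _ _ "{..<0}"])
        (use x in \<open>auto simp: W_def\<close>)
  qed
  have H: "G x * (p x)\<^sup>2 + g0 x * p x + x\<^sup>2 \<le> 0" if "x \<noteq> 0" for x
    using W1(6)[of x] W2(6)[of "- x"] that by (cases "x > 0") (auto simp: p_def)
  have pcont: "continuous_on (- {0}) p"
  proof -
    have "continuous_on {0<..} p"
      using W1(5) by (rule continuous_on_eq) (auto simp: p_def)
    moreover have "continuous_on {..<0} (\<lambda>x. - p2 (- x))"
      by (intro continuous_intros continuous_on_compose2[OF W2(5)]) auto
    then have "continuous_on {..<0} p" by (rule continuous_on_eq) (auto simp: p_def)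
    ultimately have "continuous_on ({0<..} \<union> {..<0}) p" by (intro continuous_on_open_Un) auto
    moreover have "{0<..} \<union> {..<0} = - {0::real}" by auto
    ultimately show ?thesis by simp
  qed
  have nonneg: "W x \<ge> 0" for x using pos W0 by (cases "x = 0") (auto intro: less_imp_le)
  have "proper_fun W"
    unfolding proper_fun_def
  proof (intro allI impI)
    fix a :: real
    obtain R1 where R1: "\<And>x. R1 < x \<Longrightarrow> a < W1 x" using W1(7) by blast
    obtain R2 where R2: "\<And>x. R2 < x \<Longrightarrow> a < W2 x" using W2(7) by blast
    \<comment> \<open>\<open>R1\<close> and \<open>R2\<close> may be negative; the maxima with 0
      make the interval contain 0, so each sign of \<open>x\<close> needs only its own
      bound.\<close>
    have "{x. W x \<le> a} \<subseteq> {- max R2 0..max R1 0}"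
    proof
      fix x assume "x \<in> {x. W x \<le> a}"
      then show "x \<in> {- max R2 0..max R1 0}"
        using R1[of x] R2[of "- x"] by (cases "0 \<le> x") (force simp: W_def)+
    qed
    then have "bounded {x. W x \<le> a}" using bounded_subset bounded_closed_interval by blast
    moreover have "closed {x. W x \<le> a}" by (intro closed_Collect_le cont continuous_on_const)
    ultimately show "compact {x. W x \<le> a}" by (simp add: compact_eq_bounded_closed)
  qed
  moreover have "positive_definite_fun W"
    unfolding positive_definite_fun_def using W0 pos by (metis less_irrefl)
  \<comment> \<open>Away from 0 a subgradient of \<open>W\<close> can only be the derivative
    \<open>p x\<close>, for which \<open>H\<close> holds.\<close>
  moreover have "\<zeta> \<bullet> affine_system g0 g x u \<le> - (norm x)\<^sup>2 + \<gamma> * (norm u)\<^sup>2"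
    if "x \<noteq> 0" "\<zeta> \<in> visc_subdiff W x" for x \<zeta> u
    using affine_system_dissipation_iff[OF \<open>\<gamma> > 0\<close>, of "p x" g0 g x] H[OF that(1)]
      visc_subdiff_DERIV_unique[OF der[OF that(1)] that(2)] by (simp add: G_def)
  ultimately have "W \<in> storage_W_inf (affine_system g0 g) UNIV \<gamma>"
    using cont nonneg by (auto simp: storage_W_inf_def storage_W_def)
  moreover have "W \<in> C1_0"
    unfolding C1_0_def using cont nonneg der pcont by auto
  ultimately show ?thesis unfolding W_def by simp
qed

theorem proposition4p1:
  fixes g0 :: "real \<Rightarrow> real"
    and g :: "'m::finite \<Rightarrow> real \<Rightarrow> real"
    and \<gamma> :: real
  assumes "locally_lipschitz g0"
    and "\<And>i. locally_lipschitz (g i)"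
    and "\<gamma> > 0"
    and "\<exists>V \<in> storage_W_inf (affine_system g0 g) UNIV \<gamma>. locally_lipschitz V"
  shows "storage_W_inf (affine_system g0 g) UNIV \<gamma> \<inter> C1_0 \<noteq> {}"
proof -
  obtain V where V: "V \<in> storage_W_inf (affine_system g0 g) UNIV \<gamma>" "locally_lipschitz V"
    using assms(4) by blast
  define G where "G = (\<lambda>x. \<Sum>i\<in>UNIV. (g i x)\<^sup>2 / (4 * \<gamma>))"
  have Vc: "continuous_on UNIV V" and Vp: "proper_fun V"
    using V(1) by (auto simp: storage_W_inf_def storage_W_def)
  have H: "G x * \<zeta>\<^sup>2 + g0 x * \<zeta> + x\<^sup>2 \<le> 0" if "x \<noteq> 0" "\<zeta> \<in> visc_subdiff V x" for x \<zeta>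
    using affine_system_dissipation_iff[OF \<open>\<gamma> > 0\<close>, of \<zeta> g0 g x] V(1) that
    by (auto simp: storage_W_inf_def storage_W_def G_def)
  have lip_cont: "continuous_on UNIV f" if "locally_lipschitz f" for f :: "real \<Rightarrow> real"
    using local_lipschitz_continuous_on[OF that[unfolded locally_lipschitz_def]] by blast
  have g0c: "continuous_on S g0" for S
    using lip_cont[OF assms(1)] continuous_on_subset by blast
  have Gc: "continuous_on UNIV G"
    unfolding G_def using assms(3) by (intro continuous_intros lip_cont assms(2)) auto
  have G0: "0 \<le> G x" for x unfolding G_def using assms(3) by (intro sum_nonneg) auto
  obtain W1 p1 where W1: "continuous_on {0..} W1" "W1 0 = 0" "\<And>x. 0 < x \<Longrightarrow> 0 < W1 x"
    "\<And>x. 0 < x \<Longrightarrow> (W1 has_real_derivative p1 x) (at x)" "continuous_on {0<..} p1"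
    "\<And>x. 0 < x \<Longrightarrow> G x * (p1 x)\<^sup>2 + g0 x * p1 x + x\<^sup>2 \<le> 0"
    "\<And>B. \<exists>R. \<forall>x>R. B < W1 x"
  proof (rule half_line_storage[OF Vc V(2) Vp g0c, of G])
    show "continuous_on {0<..} G" by (rule continuous_on_subset[OF Gc]) auto
  qed (use G0 H in auto)
  \<comment> \<open>In the coordinate \<open>- x\<close> the drift becomes \<open>- g0 (- x)\<close>
    and the squared input coefficients are merely reflected; subgradients change sign, so the linear
    term keeps its value.\<close>
  obtain W2 p2 where W2: "continuous_on {0..} W2" "W2 0 = 0" "\<And>x. 0 < x \<Longrightarrow> 0 < W2 x"
    "\<And>x. 0 < x \<Longrightarrow> (W2 has_real_derivative p2 x) (at x)" "continuous_on {0<..} p2"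
    "\<And>x. 0 < x \<Longrightarrow> G (- x) * (p2 x)\<^sup>2 + - g0 (- x) * p2 x + x\<^sup>2 \<le> 0"
    "\<And>B. \<exists>R. \<forall>x>R. B < W2 x"
  proof (rule half_line_storage[of "\<lambda>x. V (- x)" "\<lambda>x. - g0 (- x)" "\<lambda>x. G (- x)"])
    show "continuous_on UNIV (\<lambda>x. V (- x))"
      by (intro continuous_on_compose2[OF Vc] continuous_intros) auto
    show "continuous_on {0<..} (\<lambda>x. - g0 (- x))"
      by (intro continuous_on_compose2[OF g0c[of UNIV]] continuous_intros) auto
    show "continuous_on {0<..} (\<lambda>x. G (- x))"
      by (intro continuous_on_compose2[OF Gc] continuous_intros) auto
    show "G (- x) * \<zeta>\<^sup>2 + - g0 (- x) * \<zeta> + x\<^sup>2 \<le> 0"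
      if "0 < x" "\<zeta> \<in> visc_subdiff (\<lambda>x. V (- x)) x" for x \<zeta>
      using H[OF _ visc_subdiff_reflect[OF that(2)]] that(1) by simp
  qed (use G0 V(2) Vp in \<open>auto intro: locally_lipschitz_reflect proper_fun_reflect\<close>)
  show ?thesis
    using glue_half_line_storages[OF \<open>\<gamma> > 0\<close> W1[unfolded G_def] W2[unfolded G_def]] by blast
qed

end
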